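(* Let $k\ge 2$ be an integer. If $G$ admits a neighborhood-balanced $k$-coloring $g$ with $|V_1^g(G)|=|V_2^g(G)|=\dots=|V_k^g(G)|$ and $H$ admits a neighborhood-balanced $k$-coloring $h$ with $|V_1^h(H)|=|V_2^h(H)|=\dots=|V_k^h(H)|$, then the join $G+H$ admits a neighborhood-balanced $k$-coloring.
   Context: All graphs are finite, simple and undirected. A neighborhood-balanced $k$-coloring of a graph is a (not necessarily proper) vertex coloring with colors $1,\dots,k$ such that every vertex has the same number of neighbors of each of the $k$ colors. $V_i^g(G)$ denotes the set of vertices of $G$ with color $i$ under the coloring $g$. The join $G+H$ of (vertex-disjoint) graphs $G$ and $H$ has vertex set $V(G)\cup V(H)$ and edge set $E(G)\cup E(H)\cup\{xy: x\in V(G),\ y\in V(H)\}$. *)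

theory Defs
  imports "Graph_Theory.Pair_Digraph"
begin

text \<open>
  A finite simple undirected graph is a \<open>pair_graph\<close> of the library: a finite vertex set
  with a symmetric, irreflexive arc relation, the edge \<open>xy\<close> being represented by the two
  arcs \<open>(x, y)\<close> and \<open>(y, x)\<close>.
\<close>

definition neighborhood :: "'a pair_pre_digraph \<Rightarrow> 'a \<Rightarrow> 'a set" where
  "neighborhood G v = {u \<in> pverts G. v \<rightarrow>\<^bsub>G\<^esub> u}"

definition color_class :: "'a pair_pre_digraph \<Rightarrow> ('a \<Rightarrow> nat) \<Rightarrow> nat \<Rightarrow> 'a set" where
  "color_class G c i = {v \<in> pverts G. c v = i}"

definition nb_coloring :: "nat \<Rightarrow> 'a pair_pre_digraph \<Rightarrow> ('a \<Rightarrow> nat) \<Rightarrow> bool" where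
  "nb_coloring k G c \<longleftrightarrow>
     c \<in> pverts G \<rightarrow> {1..k} \<and>
     (\<forall>v \<in> pverts G. \<forall>i \<in> {1..k}. \<forall>j \<in> {1..k}.
        card (neighborhood G v \<inter> color_class G c i) =
        card (neighborhood G v \<inter> color_class G c j))"

definition admits_nb_coloring :: "nat \<Rightarrow> 'a pair_pre_digraph \<Rightarrow> bool" where
  "admits_nb_coloring k G \<longleftrightarrow> (\<exists>c. nb_coloring k G c)"

text \<open>The join is only meaningful for graphs with disjoint vertex sets.\<close>

definition graph_join ::
    "'a pair_pre_digraph \<Rightarrow> 'a pair_pre_digraph \<Rightarrow> 'a pair_pre_digraph" where
  "graph_join G H =
     \<lparr> pverts = pverts G \<union> pverts H,
       parcs = parcs G \<union> parcs H \<union> pverts G \<times> pverts H \<union> pverts H \<times> pverts G \<rparr>"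

lemma pair_graph_graph_join:
  assumes "pair_graph G" "pair_graph H" "pverts G \<inter> pverts H = {}"
  shows "pair_graph (graph_join G H)"
proof -
  interpret G: pair_graph G by fact
  interpret H: pair_graph H by fact
  show ?thesis
  proof unfold_locales
    show "symmetric (with_proj (graph_join G H))"
      unfolding symmetric_def
      by (rule symI) (auto simp: graph_join_def intro: G.arcs_symmetric H.arcs_symmetric)
  qed (use assms(3) in \<open>auto simp: graph_join_def dest: G.in_arcsD1 G.in_arcsD2 H.in_arcsD1
         H.in_arcsD2 G.no_loops' H.no_loops'\<close>)
qed

end

theory Submission
  imports Defs
begin

text \<open>
  Colour the join by \<open>g\<close> on \<open>G\<close> and by \<open>h\<close> on \<open>H\<close>. A vertex of \<open>G\<close> keeps its neighbours in
  \<open>G\<close> and gains every vertex of \<open>H\<close>, so its number of neighbours of colour \<open>i\<close> grows by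
  the size of the \<open>i\<close>-th colour class of \<open>H\<close> (lemma \<open>card_join_neighbors_of_color\<close>). That
  size does not depend on \<open>i\<close>, so the balance at the vertex survives. The join is symmetric in
  its two arguments, which gives the same for the vertices of \<open>H\<close>.
\<close>

lemma graph_join_commute: "graph_join G H = graph_join H G"
  by (auto simp: graph_join_def)

text \<open>
  The colouring of the join enters only through its restrictions to the two sides, so that the
  lemma can be applied to \<open>G\<close> and \<open>H\<close> in either order.
\<close>

lemma card_join_neighbors_of_color:
  assumes "pair_graph G" "pair_graph H" "pverts G \<inter> pverts H = {}"
    and c_G: "\<And>u. u \<in> pverts G \<Longrightarrow> c u = g u"
    and c_H: "\<And>u. u \<in> pverts H \<Longrightarrow> c u = h u"
    and v: "v \<in> pverts G"
  shows "card (neighborhood (graph_join G H) v \<inter> color_class (graph_join G H) c i) =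
    card (neighborhood G v \<inter> color_class G g i) + card (color_class H h i)"
proof -
  interpret G: pair_graph G by fact
  interpret H: pair_graph H by fact
  have "neighborhood (graph_join G H) v \<inter> color_class (graph_join G H) c i =
      (neighborhood G v \<inter> color_class G g i) \<union> color_class H h i"
    using assms(3) v
    by (auto simp: neighborhood_def color_class_def graph_join_def c_G c_H
        dest: G.in_arcsD2 H.in_arcsD1)
  moreover have "finite (neighborhood G v \<inter> color_class G g i)" "finite (color_class H h i)"
    by (auto simp: color_class_def)
  moreover have "(neighborhood G v \<inter> color_class G g i) \<inter> color_class H h i = {}"
    using assms(3) by (auto simp: color_class_def)
  ultimately show ?thesis
    by (simp add: card_Un_disjoint)
qed

theorem theorem3p6:
  fixes k :: nat
    and G H :: "'a pair_pre_digraph"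
    and g h :: "'a \<Rightarrow> nat"
  assumes "k \<ge> 2"
    and "pair_graph G"
    and "pair_graph H"
    and "pverts G \<inter> pverts H = {}"
    and "nb_coloring k G g"
    and "\<forall>i \<in> {1..k}. \<forall>j \<in> {1..k}. card (color_class G g i) = card (color_class G g j)"
    and "nb_coloring k H h"
    and "\<forall>i \<in> {1..k}. \<forall>j \<in> {1..k}. card (color_class H h i) = card (color_class H h j)"
  shows "admits_nb_coloring k (graph_join G H)"
proof -
  define c where "c u = (if u \<in> pverts G then g u else h u)" for u
  have c_G: "c u = g u" if "u \<in> pverts G" for u
    using that by (simp add: c_def)
  have c_H: "c u = h u" if "u \<in> pverts H" for u
    using that assms(4) by (auto simp: c_def)
  let ?J = "graph_join G H"
  have "nb_coloring k ?J c"
    unfolding nb_coloring_def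
  proof (intro conjI ballI)
    show "c \<in> pverts ?J \<rightarrow> {1..k}"
      using assms(5,7) c_G c_H by (fastforce simp: nb_coloring_def graph_join_def)
  next
    fix v i j
    assume v: "v \<in> pverts ?J" and ij: "i \<in> {1..k}" "j \<in> {1..k}"
    from v consider "v \<in> pverts G" | "v \<in> pverts H"
      by (auto simp: graph_join_def)
    then show "card (neighborhood ?J v \<inter> color_class ?J c i) =
        card (neighborhood ?J v \<inter> color_class ?J c j)"
    proof cases
      case 1
      have "card (neighborhood G v \<inter> color_class G g i) =
          card (neighborhood G v \<inter> color_class G g j)"
        using assms(5) 1 ij unfolding nb_coloring_def by blast
      moreover have "card (color_class H h i) = card (color_class H h j)"
        using assms(8) ij by blast
      ultimately show ?thesis
        by (simp only: card_join_neighbors_of_color[OF assms(2-4) c_G c_H 1])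
    next
      case 2
      have disj: "pverts H \<inter> pverts G = {}"
        using assms(4) by blast
      have "card (neighborhood H v \<inter> color_class H h i) =
          card (neighborhood H v \<inter> color_class H h j)"
        using assms(7) 2 ij unfolding nb_coloring_def by blast
      moreover have "card (color_class G g i) = card (color_class G g j)"
        using assms(6) ij by blast
      ultimately show ?thesis
        unfolding graph_join_commute[of G H]
        by (simp only: card_join_neighbors_of_color[OF assms(3,2) disj c_H c_G 2])
    qed
  qed
  then show ?thesis
    unfolding admits_nb_coloring_def by blast
qed

end
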